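(* Let $\mathbf{B}\in\{0,1\}^{n\times n}$ be a $d$-regular adjacency matrix of a directed graph. Suppose $\mathbf{B}$ has a decomposition $\mathbf{B}=\mathbf{U}\,\mathrm{diag}(\boldsymbol{\sigma})\,\mathbf{V}^{*}$ such that $\mathbf{U}\mathbf{U}^{*}=\mathbf{I}=\mathbf{V}\mathbf{V}^{*}$ and $\boldsymbol{\sigma}=(\sigma_{0},\dots,\sigma_{n-1})$. Let $\sigma_{\min}=\min_{\ell}\sigma_{\ell}$. Suppose that $\mathbf{f}\in\{0,1\}^{n\times1}$, $\mathbf{g}\in\{0,1\}^{n\times1}$ correspond to the indicator sets for row and column indices, respectively, of a rectangular zero block of $\mathbf{B}$, and that there exist $\mathbf{F},\mathbf{G}\in\mathbb{C}^{n\times1}$ such that $$\mathbf{f}=\mathbf{U}\overline{\mathbf{F}},\qquad \mathbf{g}=\mathbf{V}\mathbf{G},\qquad\text{and for all }0\le\ell<n,\ \ \mathbf{F}[\ell]\mathbf{G}[\ell]\ge0.$$ Then $$\frac{\|\mathbf{f}\|_{2}^{2}\,\|\mathbf{g}\|_{2}^{2}}{n}\le\frac{-\sigma_{\min}\sum_{0\le\ell<n}\mathbf{F}[\ell]\mathbf{G}[\ell]}{d-\sigma_{\min}}.$$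
   Context: The adjacency matrix of a directed, unweighted graph $\mathcal{G}$ on $n$ nodes is $\mathbf{B}\in\{0,1\}^{n\times n}$ with $\mathbf{B}[i,j]=1$ if and only if there is a directed edge from the $i$-th node to the $j$-th node. The graph (and its adjacency matrix) is $d$-regular if all row sums and all column sums of $\mathbf{B}$ are equal to $d$. The decomposition, with $\mathbf{U},\mathbf{V}\in\mathbb{C}^{n\times n}$, is a (non-unique) signed singular value decomposition: it resembles the singular value decomposition, but the real numbers $\sigma_\ell$ are not required to be nonnegative. The vectors $\mathbf{f},\mathbf{g}\in\{0,1\}^{n\times 1}$ indicate the row and column indices of a rectangular zero block of $\mathbf{B}$ if $\mathbf{B}[i,j]=0$ whenever $\mathbf{f}[i]=1$ and $\mathbf{g}[j]=1$. Indices run over $0,\dots,n-1$; $^{*}$ is conjugate transpose; $\overline{\mathbf{F}}$ is the entrywise conjugate; $\mathrm{diag}(\boldsymbol{\sigma})$ is the diagonal matrix with $\ell$-th diagonal entry $\sigma_\ell$; $\mathbf{I}$ is the identity matrix; for a complex number, "$\ge 0$" means real and nonnegative.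
   Formalization: Added hypotheses: some column of U is a constant vector (without it the claim fails, e.g. for the directed 2-cycle with U=B, V=diag(1,-1), σ=(1,-1), f=g=(1,0)), and d−σ_min is nonzero (otherwise the fraction is undefined, e.g. B=0). *)

theory Defs
  imports "HOL-Analysis.Analysis"
begin

text \<open>Nodes are the elements of a finite type \<open>'n\<close>, so \<open>n = CARD('n)\<close> is an arbitrary positive
  number. Loops and 2-cycles are allowed in the directed graph \<open>E\<close>; parallel edges are not.\<close>

definition adjacency_matrix :: "('n \<times> 'n) set \<Rightarrow> complex^'n^'n" where
  "adjacency_matrix E = (\<chi> i j. if (i, j) \<in> E then 1 else 0)"

definition regular_matrix :: "nat \<Rightarrow> complex^'n^'n \<Rightarrow> bool" where
  "regular_matrix d B \<longleftrightarrow>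
     (\<forall>i. (\<Sum>j\<in>UNIV. B $ i $ j) = of_nat d) \<and> (\<forall>j. (\<Sum>i\<in>UNIV. B $ i $ j) = of_nat d)"

definition conj_vec :: "complex^'n \<Rightarrow> complex^'n" where
  "conj_vec x = (\<chi> i. cnj (x $ i))"

definition conj_transpose :: "complex^'n^'m \<Rightarrow> complex^'m^'n" where
  "conj_transpose A = (\<chi> i j. cnj (A $ j $ i))"

definition diag :: "real^'n \<Rightarrow> complex^'n^'n" where
  "diag \<sigma> = (\<chi> i j. if i = j then complex_of_real (\<sigma> $ i) else 0)"

text \<open>The entries of \<open>\<sigma>\<close> may be negative.\<close>

definition signed_svd ::
    "complex^'n^'n \<Rightarrow> complex^'n^'n \<Rightarrow> real^'n \<Rightarrow> complex^'n^'n \<Rightarrow> bool" where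
  "signed_svd B U \<sigma> V \<longleftrightarrow>
     B = U ** diag \<sigma> ** conj_transpose V \<and>
     U ** conj_transpose U = mat 1 \<and> V ** conj_transpose V = mat 1"

definition zero_block :: "complex^'n^'n \<Rightarrow> complex^'n \<Rightarrow> complex^'n \<Rightarrow> bool" where
  "zero_block B f g \<longleftrightarrow>
     (\<forall>i. f $ i \<in> {0, 1}) \<and> (\<forall>j. g $ j \<in> {0, 1}) \<and>
     (\<forall>i j. f $ i = 1 \<and> g $ j = 1 \<longrightarrow> B $ i $ j = 0)"

text \<open>For a \<open>d\<close>-regular \<open>B\<close> the constant vectors are left and right singular vectors with singular
  value \<open>d\<close>. If that value has multiplicity greater than one, they need not occur (up to scaling)
  among the columns of \<open>U\<close>, and then the inequality can fail: for the directed 2-cycle \<open>B\<close> take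
  \<open>U = B\<close>, \<open>\<sigma> = (1, -1)\<close>, \<open>V = diag (1, -1)\<close>, \<open>f = g = (1, 0)\<close>; there every product
  \<open>F $ l * G $ l\<close> is \<open>0\<close>, whereas the left-hand side is \<open>1/2\<close>. Only \<open>U\<close> is constrained: if
  \<open>d > 0\<close>, the corresponding column of \<open>V\<close> is then constant as well.

  The separate hypothesis that the denominator \<open>d - \<sigma>min\<close> is nonzero makes the quotient meaningful;
  it can vanish, e.g. for \<open>B = 0\<close>, or for \<open>d = 1\<close> with all \<open>\<sigma> $ l = 1\<close>.\<close>

definition has_constant_column :: "complex^'n^'n \<Rightarrow> bool" where
  "has_constant_column U \<longleftrightarrow> (\<exists>l c. column l U = vec c)"

end

theory Submission
  imports Defs
begin

text \<open>
  The bound is a Hoffman-type ratio bound. In the coordinates given by the singular vectors the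
  bilinear form of \<open>B\<close> is diagonal, so the vanishing of \<open>f\<^sup>* B g\<close> on a zero block says that the
  weighted sum of the nonnegative numbers \<open>F\<^sub>l G\<^sub>l\<close> with weights \<open>\<sigma>\<^sub>l\<close> is zero
  (\<open>svd_bilinear_form\<close>). Regularity and the constant column of \<open>U\<close>, say with index \<open>k\<close>, determine
  one summand: \<open>\<sigma>\<^sub>k\<close> is \<open>d\<close> up to sign (\<open>constant_column_singular_value\<close>), and the summand is
  \<open>d P\<close>, where \<open>P\<close> is the left-hand side of the claim (\<open>constant_column_term\<close>). If \<open>P > 0\<close> and
  \<open>d > 0\<close>, nonnegativity of \<open>F\<^sub>k G\<^sub>k\<close> forces the sign to be plus, hence \<open>F\<^sub>k G\<^sub>k = P\<close>. Bounding
  all other weights below by \<open>\<sigma>min\<close> gives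
  \<open>0 \<ge> d P + \<sigma>min (S - P)\<close> with \<open>S = \<Sum>\<^sub>l F\<^sub>l G\<^sub>l\<close>, which rearranges to the claim.
  If \<open>P = 0\<close>, then \<open>f\<close> or \<open>g\<close> is zero and so is \<open>S\<close>. If \<open>d = 0\<close>, then \<open>B = 0\<close> and all \<open>\<sigma>\<^sub>l\<close> vanish, which is excluded by \<open>d - \<sigma>min \<noteq> 0\<close>.
\<close>

lemma unitary_left_inverse:
  fixes U :: "complex^'n^'n"
  assumes "U ** conj_transpose U = mat 1"
  shows "conj_transpose U ** U = mat 1"
  using assms matrix_left_right_inverse by blast

lemma unitary_coordinate:
  fixes U :: "complex^'n^'n"
  assumes "U ** conj_transpose U = mat 1" and "x = U *v y"
  shows "y $ l = (\<Sum>i\<in>UNIV. cnj (U $ i $ l) * x $ i)"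
proof -
  have "conj_transpose U *v x = y"
    using unitary_left_inverse[OF assms(1)] assms(2) by (simp add: matrix_vector_mul_assoc)
  then have "y $ l = (conj_transpose U *v x) $ l"
    by simp
  then show ?thesis
    by (simp add: matrix_vector_mult_def conj_transpose_def)
qed

lemma unitary_column_norm:
  fixes U :: "complex^'n^'n"
  assumes "U ** conj_transpose U = mat 1"
  shows "(\<Sum>i\<in>UNIV. (cmod (U $ i $ l))\<^sup>2) = 1"
proof -
  have "(conj_transpose U ** U) $ l $ l = 1"
    by (simp add: unitary_left_inverse[OF assms] mat_def)
  then have "(\<Sum>i\<in>UNIV. cnj (U $ i $ l) * U $ i $ l) = 1"
    by (simp add: matrix_matrix_mult_def conj_transpose_def)
  then have "complex_of_real (\<Sum>i\<in>UNIV. (cmod (U $ i $ l))\<^sup>2) = 1"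
    by (simp only: of_real_sum complex_norm_square mult.commute)
  then show ?thesis
    using of_real_eq_1_iff by blast
qed

text \<open>The entrywise form of \<open>U\<^sup>* B = diag \<sigma> V\<^sup>*\<close>.\<close>

lemma signed_svd_left_singular:
  fixes B :: "complex^'n^'n"
  assumes "signed_svd B U \<sigma> V"
  shows "(\<Sum>i\<in>UNIV. cnj (U $ i $ l) * B $ i $ j) = of_real (\<sigma> $ l) * cnj (V $ j $ l)"
proof -
  have "conj_transpose U ** B = conj_transpose U ** U ** (diag \<sigma> ** conj_transpose V)"
    using assms by (simp add: signed_svd_def matrix_mul_assoc)
  also have "\<dots> = diag \<sigma> ** conj_transpose V"
    using assms by (simp add: signed_svd_def unitary_left_inverse)
  finally have "(conj_transpose U ** B) $ l $ j = (diag \<sigma> ** conj_transpose V) $ l $ j"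
    by simp
  then show ?thesis
    by (simp add: matrix_matrix_mult_def conj_transpose_def diag_def if_distrib[of "\<lambda>x. x * _"]
        cong: if_cong)
qed

lemma svd_bilinear_form:
  fixes B :: "complex^'n^'n"
  assumes svd: "signed_svd B U \<sigma> V"
    and f: "f = U *v conj_vec F" and g: "g = V *v G"
  shows "(\<Sum>l\<in>UNIV. of_real (\<sigma> $ l) * (F $ l * G $ l)) =
    (\<Sum>i\<in>UNIV. \<Sum>j\<in>UNIV. cnj (f $ i) * B $ i $ j * g $ j)"
proof -
  have G: "G $ l = (\<Sum>j\<in>UNIV. cnj (V $ j $ l) * g $ j)" for l
    using unitary_coordinate[OF _ g] svd by (simp add: signed_svd_def)
  have f': "cnj (f $ i) = (\<Sum>l\<in>UNIV. cnj (U $ i $ l) * F $ l)" for i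
    by (simp add: f matrix_vector_mult_def conj_vec_def)
  have "of_real (\<sigma> $ l) * (F $ l * G $ l) =
      (\<Sum>j\<in>UNIV. \<Sum>i\<in>UNIV. cnj (U $ i $ l) * F $ l * B $ i $ j * g $ j)" for l
  proof -
    have "of_real (\<sigma> $ l) * (F $ l * G $ l) =
        (\<Sum>j\<in>UNIV. (of_real (\<sigma> $ l) * cnj (V $ j $ l)) * (F $ l * g $ j))"
      by (simp add: G sum_distrib_left algebra_simps)
    also have "\<dots> = (\<Sum>j\<in>UNIV. (\<Sum>i\<in>UNIV. cnj (U $ i $ l) * B $ i $ j) * (F $ l * g $ j))"
      by (simp add: signed_svd_left_singular[OF svd])
    finally show ?thesis
      by (simp add: sum_distrib_left sum_distrib_right mult_ac)
  qed
  then have "(\<Sum>l\<in>UNIV. of_real (\<sigma> $ l) * (F $ l * G $ l)) =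
      (\<Sum>l\<in>UNIV. \<Sum>j\<in>UNIV. \<Sum>i\<in>UNIV. cnj (U $ i $ l) * F $ l * B $ i $ j * g $ j)"
    by simp
  also have "\<dots> = (\<Sum>j\<in>UNIV. \<Sum>l\<in>UNIV. \<Sum>i\<in>UNIV. cnj (U $ i $ l) * F $ l * B $ i $ j * g $ j)"
    by (rule sum.swap)
  also have "\<dots> = (\<Sum>j\<in>UNIV. \<Sum>i\<in>UNIV. \<Sum>l\<in>UNIV. cnj (U $ i $ l) * F $ l * B $ i $ j * g $ j)"
    by (intro sum.cong refl sum.swap)
  also have "\<dots> = (\<Sum>i\<in>UNIV. \<Sum>j\<in>UNIV. \<Sum>l\<in>UNIV. cnj (U $ i $ l) * F $ l * B $ i $ j * g $ j)"
    by (rule sum.swap)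
  finally show ?thesis
    by (simp add: f' sum_distrib_right)
qed

lemma constant_column_norm:
  fixes U :: "complex^'n^'n"
  assumes "U ** conj_transpose U = mat 1" and "column k U = vec c"
  shows "real CARD('n) * (cmod c)\<^sup>2 = 1"
proof -
  have "U $ i $ k = c" for i
    using assms(2) by (simp add: column_def vec_eq_iff)
  then show ?thesis
    using unitary_column_norm[OF assms(1), of k] by simp
qed

text \<open>Summing the rows of \<open>B\<close> with the constant weight \<open>cnj c\<close> picks up the column sums, so the
  \<open>k\<close>-th column of \<open>V\<close> is itself constant once it is scaled by \<open>\<sigma>\<^sub>k\<close>.\<close>

lemma constant_column_right_singular:
  fixes B :: "complex^'n^'n"
  assumes "signed_svd B U \<sigma> V" and "regular_matrix d B" and "column k U = vec c"
  shows "of_real (\<sigma> $ k) * cnj (V $ j $ k) = cnj c * of_nat d"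
proof -
  have "U $ i $ k = c" for i
    using assms(3) by (simp add: column_def vec_eq_iff)
  then show ?thesis
    using signed_svd_left_singular[OF assms(1), of k j] assms(2)
    by (simp add: regular_matrix_def flip: sum_distrib_left)
qed

text \<open>Compare the squared norms of the two sides of
  \<open>constant_column_right_singular\<close>, using that the columns of \<open>U\<close> and \<open>V\<close> are unit vectors.\<close>

lemma constant_column_singular_value:
  fixes B :: "complex^'n^'n"
  assumes svd: "signed_svd B U \<sigma> V" and reg: "regular_matrix d B" and c: "column k U = vec c"
  shows "(\<sigma> $ k)\<^sup>2 = (real d)\<^sup>2"
proof -
  have "cmod (of_real (\<sigma> $ k) * cnj (V $ j $ k)) = cmod (cnj c * of_nat d)" for j
    by (simp only: constant_column_right_singular[OF svd reg c])
  then have "\<bar>\<sigma> $ k\<bar> * cmod (V $ j $ k) = cmod c * real d" for j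
    by (simp add: norm_mult)
  then have "(\<bar>\<sigma> $ k\<bar> * cmod (V $ j $ k))\<^sup>2 = (cmod c * real d)\<^sup>2" for j
    by simp
  then have eq: "(\<sigma> $ k)\<^sup>2 * (cmod (V $ j $ k))\<^sup>2 = (cmod c)\<^sup>2 * (real d)\<^sup>2" for j
    by (simp add: power_mult_distrib)
  have "(\<sigma> $ k)\<^sup>2 = (\<sigma> $ k)\<^sup>2 * (\<Sum>j\<in>UNIV. (cmod (V $ j $ k))\<^sup>2)"
    using svd by (simp add: unitary_column_norm signed_svd_def)
  also have "\<dots> = (real CARD('n) * (cmod c)\<^sup>2) * (real d)\<^sup>2"
    by (simp add: sum_distrib_left eq)
  also have "\<dots> = (real d)\<^sup>2"
    using constant_column_norm[OF _ c] svd by (simp add: signed_svd_def)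
  finally show ?thesis .
qed

lemma sum_indicator_vec:
  fixes f :: "complex^'n"
  assumes "\<forall>i. f $ i \<in> {0, 1}"
  shows "(\<Sum>i\<in>UNIV. f $ i) = of_real ((norm f)\<^sup>2)"
proof -
  have "f $ i = of_real ((cmod (f $ i))\<^sup>2)" for i
    using assms[rule_format, of i] by auto
  then have "(\<Sum>i\<in>UNIV. f $ i) = (\<Sum>i\<in>UNIV. of_real ((cmod (f $ i))\<^sup>2))"
    by (intro sum.cong) auto
  also have "\<dots> = of_real ((norm f)\<^sup>2)"
    by (simp add: norm_vec_def L2_set_def sum_nonneg)
  finally show ?thesis .
qed

text \<open>Up to the factors \<open>c\<close> and \<open>cnj c\<close>, the numbers \<open>F\<^sub>k\<close> and \<open>\<sigma>\<^sub>k G\<^sub>k\<close> are the entry sums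
  of \<open>f\<close> and \<open>d g\<close>. The entry sum of a \<open>0/1\<close> vector is its squared norm, and \<open>\<bar>c\<bar>\<^sup>2\<close> is the
  reciprocal of the number of nodes.\<close>

lemma constant_column_term:
  fixes B :: "complex^'n^'n"
  assumes svd: "signed_svd B U \<sigma> V" and reg: "regular_matrix d B" and c: "column k U = vec c"
    and f01: "\<forall>i. f $ i \<in> {0, 1}" and g01: "\<forall>i. g $ i \<in> {0, 1}"
    and f: "f = U *v conj_vec F" and g: "g = V *v G"
  shows "of_real (\<sigma> $ k) * (F $ k * G $ k) =
    of_real (real d * ((norm f)\<^sup>2 * (norm g)\<^sup>2 / real CARD('n)))"
proof -
  have U: "U $ i $ k = c" for i
    using c by (simp add: column_def vec_eq_iff)
  have "cnj (F $ k) = cnj c * (\<Sum>i\<in>UNIV. f $ i)"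
    using unitary_coordinate[OF _ f, of k] svd
    by (simp add: signed_svd_def conj_vec_def U sum_distrib_left)
  then have "cnj (cnj (F $ k)) = cnj (cnj c * of_real ((norm f)\<^sup>2))"
    by (simp only: sum_indicator_vec[OF f01])
  then have F: "F $ k = c * of_real ((norm f)\<^sup>2)"
    by simp
  have "of_real (\<sigma> $ k) * G $ k = (\<Sum>j\<in>UNIV. (of_real (\<sigma> $ k) * cnj (V $ j $ k)) * g $ j)"
    using unitary_coordinate[OF _ g, of k] svd
    by (simp add: signed_svd_def sum_distrib_left mult.assoc)
  also have "\<dots> = cnj c * of_nat d * of_real ((norm g)\<^sup>2)"
    by (simp only: constant_column_right_singular[OF svd reg c] sum_indicator_vec[OF g01]
        flip: sum_distrib_left)
  finally have G: "of_real (\<sigma> $ k) * G $ k = cnj c * of_nat d * of_real ((norm g)\<^sup>2)" .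
  have "c * cnj c = of_real ((cmod c)\<^sup>2)"
    by (simp only: complex_norm_square)
  also have "(cmod c)\<^sup>2 = 1 / real CARD('n)"
    using constant_column_norm[OF _ c] svd by (simp add: signed_svd_def field_simps)
  finally have cc: "c * cnj c = of_real (1 / real CARD('n))" .
  have "of_real (\<sigma> $ k) * (F $ k * G $ k) = F $ k * (of_real (\<sigma> $ k) * G $ k)"
    by (simp add: algebra_simps)
  also have "\<dots> = (c * cnj c) * of_real (real d * ((norm f)\<^sup>2 * (norm g)\<^sup>2))"
    unfolding F G by (simp add: algebra_simps)
  also have "\<dots> = of_real (real d * ((norm f)\<^sup>2 * (norm g)\<^sup>2 / real CARD('n)))"
    unfolding cc by simp
  finally show ?thesis .
qed

lemma zero_regular_adjacency_matrix:
  fixes E :: "('n::finite \<times> 'n) set"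
  assumes "regular_matrix 0 (adjacency_matrix E)"
  shows "adjacency_matrix E = 0"
proof -
  have "adjacency_matrix E $ i $ j = 0" for i j
  proof -
    have "(\<Sum>j\<in>UNIV. Re (adjacency_matrix E $ i $ j)) = 0"
      using assms by (simp add: regular_matrix_def flip: Re_sum)
    then have "Re (adjacency_matrix E $ i $ j) = 0"
      by (subst (asm) sum_nonneg_eq_0_iff) (auto simp: adjacency_matrix_def)
    then show ?thesis
      by (simp add: adjacency_matrix_def split: if_splits)
  qed
  then show ?thesis
    by (simp add: vec_eq_iff)
qed

lemma signed_svd_zero:
  fixes U V :: "complex^'n^'n"
  assumes "signed_svd 0 U \<sigma> V"
  shows "\<sigma> $ l = 0"
proof (rule ccontr)
  assume "\<sigma> $ l \<noteq> 0"
  then have "V $ j $ l = 0" for j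
    using signed_svd_left_singular[OF assms, of l j] by simp
  then show False
    using unitary_column_norm[of V l] assms by (simp add: signed_svd_def)
qed

text \<open>The final rearrangement, for real numbers \<open>t\<^sub>l\<close> in the role of \<open>F\<^sub>l G\<^sub>l\<close>.\<close>

lemma weighted_sum_ratio_bound:
  fixes s t :: "'a::finite \<Rightarrow> real"
  assumes "(\<Sum>l\<in>UNIV. s l * t l) = 0" and "\<And>l. t l \<ge> 0" and "\<And>l. m \<le> s l" and "m < s k"
  shows "t k \<le> - m * (\<Sum>l\<in>UNIV. t l) / (s k - m)"
proof -
  have "(s k - m) * t k \<le> (\<Sum>l\<in>UNIV. (s l - m) * t l)"
    using assms by (intro member_le_sum) auto
  also have "\<dots> = - m * (\<Sum>l\<in>UNIV. t l)"
    using assms(1) by (simp add: left_diff_distrib sum_subtractf flip: sum_distrib_left)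
  finally show ?thesis
    using assms(4) by (simp add: field_simps)
qed

theorem corollary3p7:
  fixes E :: "('n::finite \<times> 'n) set"
    and B U V :: "complex^'n^'n"
    and \<sigma> :: "real^'n"
    and f g F G :: "complex^'n"
    and d :: nat
    and \<sigma>min :: real
  assumes "B = adjacency_matrix E"
    and "regular_matrix d B"
    and "signed_svd B U \<sigma> V"
    and "has_constant_column U"
    and "\<sigma>min = Min (range (\<lambda>l. \<sigma> $ l))"
    and "real d - \<sigma>min \<noteq> 0"
    and "zero_block B f g"
    and "f = U *v conj_vec F"
    and "g = V *v G"
    and "\<forall>l. F $ l * G $ l \<in> \<real>\<^sub>\<ge>\<^sub>0"
  shows "(norm f)\<^sup>2 * (norm g)\<^sup>2 / real CARD('n)
           \<le> - \<sigma>min * Re (\<Sum>l\<in>UNIV. F $ l * G $ l) / (real d - \<sigma>min)"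
proof -
  note svd = assms(3)
  have f01: "\<forall>i. f $ i \<in> {0, 1}" and g01: "\<forall>i. g $ i \<in> {0, 1}"
    using assms(7) by (auto simp: zero_block_def)
  obtain k c where c: "column k U = vec c"
    using assms(4) by (auto simp: has_constant_column_def)
  define t where "t l = Re (F $ l * G $ l)" for l
  define P where "P = (norm f)\<^sup>2 * (norm g)\<^sup>2 / real CARD('n)"
  have t: "F $ l * G $ l = of_real (t l)" "t l \<ge> 0" for l
    using assms(10)[rule_format, of l] unfolding t_def
    by (auto elim!: nonneg_Reals_cases simp del: times_complex.simps)
  have min: "\<sigma>min \<le> \<sigma> $ l" for l
    by (simp add: assms(5))
  have sum0: "(\<Sum>l\<in>UNIV. \<sigma> $ l * t l) = 0"
  proof -
    have "cnj (f $ i) * B $ i $ j * g $ j = 0" for i j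
      using assms(7) f01[rule_format, of i] g01[rule_format, of j]
      by (auto simp: zero_block_def)
    then have "(\<Sum>i\<in>UNIV. \<Sum>j\<in>UNIV. cnj (f $ i) * B $ i $ j * g $ j) = 0"
      by (simp only: sum.neutral_const)
    then have "complex_of_real (\<Sum>l\<in>UNIV. \<sigma> $ l * t l) = 0"
      using svd_bilinear_form[OF svd assms(8,9)] by (simp add: t(1))
    then show ?thesis
      using of_real_eq_0_iff by blast
  qed
  have "complex_of_real (\<sigma> $ k * t k) = of_real (real d * P)"
    using constant_column_term[OF svd assms(2) c f01 g01 assms(8,9)]
    by (simp add: t(1) P_def)
  then have k: "\<sigma> $ k * t k = real d * P"
    using of_real_eq_iff by blast
  have d: "d > 0"
  proof (rule ccontr)
    assume "\<not> d > 0"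
    then have "signed_svd 0 U \<sigma> V"
      using assms(1,2) svd zero_regular_adjacency_matrix[of E] by auto
    then show False
      using assms(5,6) \<open>\<not> d > 0\<close> signed_svd_zero[of U \<sigma> V] by simp
  qed
  have S: "Re (\<Sum>l\<in>UNIV. F $ l * G $ l) = (\<Sum>l\<in>UNIV. t l)"
    by (simp add: t_def)
  have "P \<le> - \<sigma>min * (\<Sum>l\<in>UNIV. t l) / (real d - \<sigma>min)"
  proof (cases "P = 0")
    case True
    then have "f = 0 \<or> g = 0"
      by (simp add: P_def)
    then have "F $ l * G $ l = 0" for l
    proof
      assume "f = 0"
      then have "cnj (F $ l) = 0"
        using unitary_coordinate[OF _ assms(8), of l] svd
        by (simp add: signed_svd_def conj_vec_def)
      then show ?thesis
        by simp
    next
      assume "g = 0"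
      then show ?thesis
        using unitary_coordinate[OF _ assms(9), of l] svd by (simp add: signed_svd_def)
    qed
    then have "t l = 0" for l
      by (simp only: t_def zero_complex.sel)
    then show ?thesis
      using True by simp
  next
    case False
    then have "P > 0"
      by (simp add: P_def)
    then have "\<sigma> $ k * t k > 0"
      using d k by simp
    then have "\<sigma> $ k > 0"
      using t(2)[of k] by (simp add: zero_less_mult_iff)
    then have \<sigma>k: "\<sigma> $ k = real d"
      using constant_column_singular_value[OF svd assms(2) c] by (simp add: power2_eq_iff)
    then have "t k = P"
      using k d by simp
    moreover have "\<sigma>min < \<sigma> $ k"
      using min[of k] assms(6) \<sigma>k by simp
    ultimately show ?thesis
      using weighted_sum_ratio_bound[OF sum0 t(2) min, of k] \<sigma>k by simp
  qed
  then show ?thesis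
    by (simp only: P_def S)
qed

end
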